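(* Let $n,i,j$ be integers with $1\le i<j\le n$, let $k$ be a field, let $R=k[x_1,\dots,x_n]$, let $I=(x_1^2,\dots,x_n^2)+\mathrm{RLex}(x_ix_j)$, and let $A=R/I$. Let $D$ be the largest degree with $A_D\neq 0$. Then the sequence $(\dim_k A_d)_{d=0}^{D}$ of coefficients of the Hilbert series $\mathrm{HS}(A;t)$ is mid-heavy.
   Context: The reverse lexicographic order with $x_1>\cdots>x_n$: for two monomials of the same degree, $x_1^{a_1}\cdots x_n^{a_n}>x_1^{b_1}\cdots x_n^{b_n}$ if the last non-zero entry of $(a_1,\dots,a_n)-(b_1,\dots,b_n)$ is negative. For $1\le i<j\le n$, $\mathrm{RLex}(x_ix_j)$ is the ideal of $R$ generated by all square-free monomials of degree 2 that are greater than or equal to $x_ix_j$ in this order; that is, by all $x_ax_b$ with $1\le a<b\le j-1$ together with $x_ax_j$ for $1\le a\le i$. The Hilbert series of a standard graded $k$-algebra $A=\bigoplus_{d\ge0}A_d$ is $\mathrm{HS}(A;t)=\sum_{d\ge 0}\dim_k(A_d)\,t^d$. A sequence of positive integers $(a_m)_{m=0}^N$, extended by $a_m=0$ for $m<0$ and $m>N$, is called mid-heavy if for all integers $p<q$ with at least one of $p,q$ in $[0,N]$: $a_p\le a_q$ implies $a_{p-1}\le a_{q+1}$, and $a_p\ge a_q$ implies $a_{p-1}\ge a_{q+1}$. *)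

theory Defs
  imports
    "HOL-Library.Poly_Mapping"
    "HOL-Algebra.QuotRing"
    "HOL-Algebra.Embedded_Algebras"
    "HOL-Computational_Algebra.Formal_Power_Series"
begin

text \<open>
  A monomial is its exponent vector, of type \<^typ>\<open>nat \<Rightarrow>\<^sub>0 nat\<close>, and a polynomial is a finitely
  supported function from monomials to coefficients; the type class operations on
  \<^typ>\<open>(nat \<Rightarrow>\<^sub>0 nat) \<Rightarrow>\<^sub>0 'k\<close> are those of the polynomial ring in the infinitely many variables
  indexed by \<^typ>\<open>nat\<close>.  The ring in \<open>x\<^sub>1, \<dots>, x\<^sub>n\<close> is cut out by its carrier.
\<close>

definition monomials :: "nat \<Rightarrow> (nat \<Rightarrow>\<^sub>0 nat) set" where
  "monomials n = {m. Poly_Mapping.keys m \<subseteq> {1..n}}"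

definition mdeg :: "(nat \<Rightarrow>\<^sub>0 nat) \<Rightarrow> nat" where
  "mdeg m = (\<Sum>v\<in>Poly_Mapping.keys m. Poly_Mapping.lookup m v)"

definition mvar :: "nat \<Rightarrow> nat \<Rightarrow>\<^sub>0 nat" where
  "mvar v = Poly_Mapping.single v 1"

definition monom_poly :: "(nat \<Rightarrow>\<^sub>0 nat) \<Rightarrow> (nat \<Rightarrow>\<^sub>0 nat) \<Rightarrow>\<^sub>0 'k::field" where
  "monom_poly m = Poly_Mapping.single m 1"

definition const_poly :: "'k::field \<Rightarrow> (nat \<Rightarrow>\<^sub>0 nat) \<Rightarrow>\<^sub>0 'k" where
  "const_poly c = Poly_Mapping.single 0 c"

definition mpoly_ring :: "nat \<Rightarrow> ((nat \<Rightarrow>\<^sub>0 nat) \<Rightarrow>\<^sub>0 'k::field) ring" where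
  "mpoly_ring n = \<lparr>carrier = {f. Poly_Mapping.keys f \<subseteq> monomials n},
     monoid.mult = (*), one = 1, zero = 0, add = (+)\<rparr>"

definition homogeneous :: "nat \<Rightarrow> ((nat \<Rightarrow>\<^sub>0 nat) \<Rightarrow>\<^sub>0 'k::field) \<Rightarrow> bool" where
  "homogeneous d f \<longleftrightarrow> (\<forall>m\<in>Poly_Mapping.keys f. mdeg m = d)"

definition rlex_greater :: "(nat \<Rightarrow>\<^sub>0 nat) \<Rightarrow> (nat \<Rightarrow>\<^sub>0 nat) \<Rightarrow> bool" where
  "rlex_greater a b \<longleftrightarrow> mdeg a = mdeg b \<and>
     (\<exists>l. Poly_Mapping.lookup a l < Poly_Mapping.lookup b l \<and>
          (\<forall>l'>l. Poly_Mapping.lookup a l' = Poly_Mapping.lookup b l'))"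

definition squarefree_monomial :: "(nat \<Rightarrow>\<^sub>0 nat) \<Rightarrow> bool" where
  "squarefree_monomial m \<longleftrightarrow> (\<forall>v. Poly_Mapping.lookup m v \<le> 1)"

definition rlex_monomials :: "nat \<Rightarrow> (nat \<Rightarrow>\<^sub>0 nat) \<Rightarrow> (nat \<Rightarrow>\<^sub>0 nat) set" where
  "rlex_monomials n u =
     {m \<in> monomials n. squarefree_monomial m \<and> mdeg m = 2 \<and> (m = u \<or> rlex_greater m u)}"

definition RLex :: "nat \<Rightarrow> (nat \<Rightarrow>\<^sub>0 nat) \<Rightarrow> ((nat \<Rightarrow>\<^sub>0 nat) \<Rightarrow>\<^sub>0 'k::field) set" where
  "RLex n u = Idl\<^bsub>mpoly_ring n\<^esub> (monom_poly ` rlex_monomials n u)"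

definition squares_ideal :: "nat \<Rightarrow> ((nat \<Rightarrow>\<^sub>0 nat) \<Rightarrow>\<^sub>0 'k::field) set" where
  "squares_ideal n = Idl\<^bsub>mpoly_ring n\<^esub> ((\<lambda>v. monom_poly (mvar v) ^ 2) ` {1..n})"

text \<open>
  For a homogeneous ideal \<open>I\<close>, \<open>quot_scalars n I\<close> is the copy of the ground field inside
  \<open>A = mpoly_ring n Quot I\<close>, and \<open>quot_graded n I d\<close> is \<open>A\<^sub>d\<close>, the image of the forms of degree
  \<open>d\<close> (the zero form included).
\<close>

definition quot_scalars ::
    "nat \<Rightarrow> ((nat \<Rightarrow>\<^sub>0 nat) \<Rightarrow>\<^sub>0 'k::field) set \<Rightarrow> ((nat \<Rightarrow>\<^sub>0 nat) \<Rightarrow>\<^sub>0 'k) set set" where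
  "quot_scalars n I = range (\<lambda>c. I +>\<^bsub>mpoly_ring n\<^esub> const_poly c)"

definition quot_graded ::
    "nat \<Rightarrow> ((nat \<Rightarrow>\<^sub>0 nat) \<Rightarrow>\<^sub>0 'k::field) set \<Rightarrow> nat \<Rightarrow> ((nat \<Rightarrow>\<^sub>0 nat) \<Rightarrow>\<^sub>0 'k) set set" where
  "quot_graded n I d =
     (\<lambda>f. I +>\<^bsub>mpoly_ring n\<^esub> f) ` {f \<in> carrier (mpoly_ring n). homogeneous d f}"

text \<open>
  The Hilbert series of an algebra \<open>A\<close> over a subfield \<open>K\<close> of \<open>A\<close>, graded by the subspaces
  \<open>gr d\<close>.
\<close>

definition hilbert_series :: "('a, 'b) ring_scheme \<Rightarrow> 'a set \<Rightarrow> (nat \<Rightarrow> 'a set) \<Rightarrow> nat fps" where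
  "hilbert_series A K gr = Abs_fps (\<lambda>d. (ring.dim A over K) (gr d))"

definition top_degree :: "('a, 'b) ring_scheme \<Rightarrow> (nat \<Rightarrow> 'a set) \<Rightarrow> nat" where
  "top_degree A gr = (GREATEST d. gr d \<noteq> {\<zero>\<^bsub>A\<^esub>})"

definition zero_extend :: "nat \<Rightarrow> (nat \<Rightarrow> nat) \<Rightarrow> int \<Rightarrow> nat" where
  "zero_extend N a m = (if 0 \<le> m \<and> m \<le> int N then a (nat m) else 0)"

text \<open>Only the values \<open>a 0, \<dots>, a N\<close> matter; positivity is part of the notion.\<close>

definition mid_heavy :: "nat \<Rightarrow> (nat \<Rightarrow> nat) \<Rightarrow> bool" where
  "mid_heavy N a \<longleftrightarrow> (\<forall>m\<le>N. 0 < a m) \<and>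
     (\<forall>p q. p < q \<and> (p \<in> {0..int N} \<or> q \<in> {0..int N}) \<longrightarrow>
       (zero_extend N a p \<le> zero_extend N a q \<longrightarrow>
          zero_extend N a (p - 1) \<le> zero_extend N a (q + 1)) \<and>
       (zero_extend N a p \<ge> zero_extend N a q \<longrightarrow>
          zero_extend N a (p - 1) \<ge> zero_extend N a (q + 1)))"

end

theory Submission
  imports Defs
begin

text \<open>
  A basis of \<open>A\<close> is given by the monomials outside the monomial ideal \<open>I\<close>; these are the square-free
  monomials whose support is an independent set of the graph on \<open>{1, \<dots>, n}\<close> whose edges are the
  generators of \<open>RLex(x\<^sub>i x\<^sub>j)\<close>.  The vertices beyond \<open>j\<close> are isolated, and among \<open>1, \<dots>, j\<close> the only
  non-edges are \<open>{a, j}\<close> with \<open>i < a < j\<close>, whence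
  \<open>HS(A; t) = (1 + t)^(n - j) (1 + j t + (j - 1 - i) t^2)\<close>.  The last factor has mid-heavy
  coefficients, and multiplication by \<open>1 + t\<close> preserves mid-heaviness: if \<open>b\<^sub>p = a\<^sub>p + a\<^sub>p\<^sub>-\<^sub>1\<close>, then
  \<open>b\<^sub>q - b\<^sub>p\<close> is the sum of \<open>a\<^sub>q\<^sub>-\<^sub>1 - a\<^sub>p\<close> and \<open>a\<^sub>q - a\<^sub>p\<^sub>-\<^sub>1\<close>, two differences of
  terms with the same index sum, whose signs are tied together by mid-heaviness of \<open>a\<close>.
\<close>

section \<open>Mid-heavy sequences\<close>

lemma mid_heavyD:
  assumes "mid_heavy N a" and "p < q" and "p \<in> {0..int N} \<or> q \<in> {0..int N}"
  shows "zero_extend N a p \<le> zero_extend N a q \<Longrightarrow>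
      zero_extend N a (p - 1) \<le> zero_extend N a (q + 1)"
    and "zero_extend N a p \<ge> zero_extend N a q \<Longrightarrow>
      zero_extend N a (p - 1) \<ge> zero_extend N a (q + 1)"
  using assms unfolding mid_heavy_def by blast+

lemma mid_heavy_add_shift:
  assumes mh: "mid_heavy N a" and "a (Suc N) = 0"
    and b0: "b 0 = a 0" and bS: "\<And>d. b (Suc d) = a (Suc d) + a d"
  shows "mid_heavy (Suc N) b"
proof -
  define f where "f = zero_extend N a"
  have f0: "f p = 0" if "p < 0 \<or> p > int N" for p
    using that by (auto simp: f_def zero_extend_def)
  \<comment> \<open>At index N + 1 the extension \<open>f\<close> is 0 while the recursion for
    \<open>b\<close> involves \<open>a (Suc N)\<close>; the assumption \<open>a (Suc N) = 0\<close>
    makes the two agree.\<close>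
  have g: "zero_extend (Suc N) b p = f p + f (p - 1)" for p
  proof (cases "0 \<le> p \<and> p \<le> int (Suc N)")
    case True
    then obtain d where d: "p = int d" "d \<le> Suc N"
      by (metis nonneg_int_cases of_nat_le_iff)
    show ?thesis
    proof (cases d)
      case 0
      then show ?thesis using d b0 by (simp add: f_def zero_extend_def)
    next
      case (Suc e)
      then show ?thesis
        using d bS[of e] assms(2) by (auto simp: f_def zero_extend_def le_Suc_eq nat_add_distrib)
    qed
  qed (auto simp: f_def zero_extend_def)
  have le: "f (p - 1) \<le> f (q + 1)" if "p < q" "p \<in> {0..int N} \<or> q \<in> {0..int N}" "f p \<le> f q" for p q
    using mid_heavyD(1)[OF mh that(1,2)] that(3) by (simp add: f_def)
  have ge: "f (p - 1) \<ge> f (q + 1)" if "p < q" "p \<in> {0..int N} \<or> q \<in> {0..int N}" "f p \<ge> f q" for p q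
    using mid_heavyD(2)[OF mh that(1,2)] that(3) by (simp add: f_def)
  have pos: "0 < b m" if "m \<le> Suc N" for m
  proof (cases m)
    case 0
    then show ?thesis using mh b0 by (simp add: mid_heavy_def)
  next
    case (Suc d)
    then show ?thesis using mh bS[of d] that by (simp add: mid_heavy_def)
  qed
  have "(f p + f (p - 1) \<le> f q + f (q - 1) \<longrightarrow> f (p - 1) + f (p - 2) \<le> f (q + 1) + f q) \<and>
      (f p + f (p - 1) \<ge> f q + f (q - 1) \<longrightarrow> f (p - 1) + f (p - 2) \<ge> f (q + 1) + f q)"
    if pq: "p < q" "p \<in> {0..int (Suc N)} \<or> q \<in> {0..int (Suc N)}" for p q
  proof -
    \<comment> \<open>This is mid-heaviness at the pair (p - 1, q). If neither index lies in [0, N],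
      then p - 1 < 0 and q > N, so both outer values vanish.\<close>
    have outer: "(f (p - 1) \<le> f q \<longrightarrow> f (p - 2) \<le> f (q + 1)) \<and>
        (f (p - 1) \<ge> f q \<longrightarrow> f (p - 2) \<ge> f (q + 1))"
      using le[of "p - 1" q] ge[of "p - 1" q] f0[of "p - 2"] f0[of "q + 1"] f0[of "p - 1"] f0[of q] pq
      by (cases "p - 1 \<in> {0..int N} \<or> q \<in> {0..int N}") auto
    show ?thesis
    \<comment> \<open>The pair (p, q - 1) is degenerate when q = p + 1: then \<open>f p\<close> and
      \<open>f (q - 1)\<close> cancel and \<open>outer\<close> alone suffices.\<close>
    proof (cases "q = p + 1")
      case True
      then show ?thesis using outer by auto
    next
      case False
      show ?thesis
      proof (cases "p \<in> {0..int N} \<or> q - 1 \<in> {0..int N}")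
        case True
        with False le[of p "q - 1"] ge[of p "q - 1"] pq(1)
        have "(f p \<le> f (q - 1) \<longrightarrow> f (p - 1) \<le> f q) \<and> (f p \<ge> f (q - 1) \<longrightarrow> f (p - 1) \<ge> f q)"
          by auto
        \<comment> \<open>If f(q) < f(p - 1), the implication just shown would give f(q - 1) < f(p),
          so b(q) < b(p). Hence b(p) <= b(q) forces f(p - 1) <= f(q), and \<open>outer\<close>
          supplies the other summand. The reverse inequality is symmetric.\<close>
        with outer show ?thesis by linarith
      next
        case False
        then have "f p = 0" "f (q - 1) = 0" using f0 by auto
        with outer f0[of q] f0[of "q - 1"] show ?thesis by auto
      qed
    qed
  qed
  then show ?thesis
    using pos unfolding mid_heavy_def g by (simp add: algebra_simps)
qed

section \<open>Independent sets\<close>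

text \<open>For a < b the condition is the negation of "b < j, or b = j and a <= i", which says that
  x_a x_b is a generator.\<close>

definition rlex_independent :: "nat \<Rightarrow> nat \<Rightarrow> nat set \<Rightarrow> bool" where
  "rlex_independent i j T \<longleftrightarrow> (\<forall>a\<in>T. \<forall>b\<in>T. a < b \<longrightarrow> j < b \<or> b = j \<and> i < a)"

definition independent_sets :: "nat \<Rightarrow> nat \<Rightarrow> nat \<Rightarrow> nat \<Rightarrow> nat set set" where
  "independent_sets i j n d = {T. T \<subseteq> {1..n} \<and> card T = d \<and> rlex_independent i j T}"

lemma finite_independent_sets: "finite (independent_sets i j n d)"
  by (rule finite_subset[of _ "Pow {1..n}"]) (auto simp: independent_sets_def)

lemma independent_sets_0: "independent_sets i j n 0 = {{}}"
  by (auto simp: independent_sets_def rlex_independent_def finite_subset card_eq_0_iff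
      dest: finite_subset)

text \<open>The vertex n + 1 exceeds j and is therefore isolated: it may be added to any independent
  set. Splitting by whether it is present gives the recursion, which is multiplication of the
  generating polynomial by 1 + t.\<close>

lemma card_independent_sets_Suc:
  assumes "j \<le> n"
  shows "card (independent_sets i j (Suc n) (Suc d)) =
    card (independent_sets i j n (Suc d)) + card (independent_sets i j n d)"
proof -
  have mem: "T \<in> independent_sets i j (Suc n) (Suc d) \<longleftrightarrow>
      T \<in> independent_sets i j n (Suc d) \<union> insert (Suc n) ` independent_sets i j n d" (is "?L \<longleftrightarrow> ?R") for T
  proof
    assume T: ?L
    then have fin: "finite T" by (auto simp: independent_sets_def intro: finite_subset)
    show ?R
    proof (cases "Suc n \<in> T")
      case True
      then have "T = insert (Suc n) (T - {Suc n})" by blast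
      moreover have "T - {Suc n} \<in> independent_sets i j n d"
        using T True fin by (fastforce simp: independent_sets_def rlex_independent_def le_Suc_eq)
      ultimately show ?thesis by blast
    next
      case False
      then have "T \<in> independent_sets i j n (Suc d)"
        using T by (fastforce simp: independent_sets_def le_Suc_eq)
      then show ?thesis by blast
    qed
  next
    assume ?R
    then show ?L
    proof
      assume "T \<in> independent_sets i j n (Suc d)"
      then show ?L by (auto simp: independent_sets_def)
    next
      assume "T \<in> insert (Suc n) ` independent_sets i j n d"
      then obtain S where S: "S \<in> independent_sets i j n d" "T = insert (Suc n) S" by blast
      moreover from S have "finite S" "Suc n \<notin> S"
        by (auto simp: independent_sets_def intro: finite_subset)
      ultimately show ?L
        using assms by (fastforce simp: independent_sets_def rlex_independent_def)
    qed
  qed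
  have notin: "Suc n \<notin> S" if "S \<in> independent_sets i j n e" for S e
    using that by (auto simp: independent_sets_def)
  have "inj_on (insert (Suc n)) (independent_sets i j n d)"
    using notin by (intro inj_onI) (metis insert_ident)
  moreover have "independent_sets i j n (Suc d) \<inter> insert (Suc n) ` independent_sets i j n d = {}"
    using notin by blast
  moreover have "independent_sets i j (Suc n) (Suc d) =
      independent_sets i j n (Suc d) \<union> insert (Suc n) ` independent_sets i j n d"
    using mem by blast
  ultimately show ?thesis
    by (simp add: card_Un_disjoint finite_independent_sets card_image)
qed

lemma card_independent_sets_1: "card (independent_sets i j n 1) = n"
proof -
  have "independent_sets i j n 1 = (\<lambda>a. {a}) ` {1..n}"
    by (auto simp: independent_sets_def rlex_independent_def card_1_singleton_iff)
  then show ?thesis by (simp add: card_image)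
qed

lemma card_independent_sets_2:
  assumes "i < j" shows "card (independent_sets i j j 2) = j - 1 - i"
proof -
  have "independent_sets i j j 2 = (\<lambda>a. {a, j}) ` {i<..<j}" (is "?A = ?B")
  proof
    show "?A \<subseteq> ?B"
    proof
      fix T assume T: "T \<in> ?A"
      then obtain x y where xy: "T = {x, y}" "x \<noteq> y"
        by (auto simp: independent_sets_def card_2_iff)
      obtain a b where "T = {a, b}" "a < b"
        using xy by (metis insert_commute linorder_neqE_nat)
      with T have "b = j" "i < a" "a < j"
        by (auto simp: independent_sets_def rlex_independent_def)
      with \<open>T = {a, b}\<close> show "T \<in> ?B" by auto
    qed
    show "?B \<subseteq> ?A"
      using assms by (auto simp: independent_sets_def rlex_independent_def)
  qed
  moreover have "inj_on (\<lambda>a. {a, j}) {i<..<j}"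
    by (auto simp: inj_on_def doubleton_eq_iff)
  ultimately show ?thesis by (simp add: card_image)
qed

text \<open>The vertices below j are pairwise adjacent, so an independent set contains at most one
  of them besides possibly j.\<close>

lemma independent_sets_ge_3:
  assumes "3 \<le> d" shows "independent_sets i j j d = {}"
proof -
  have False if T: "T \<in> independent_sets i j j d" for T
  proof -
    have fin: "finite T" using T by (auto simp: independent_sets_def intro: finite_subset)
    have "card (T - {j}) \<le> 1"
    proof (rule ccontr)
      assume "\<not> ?thesis"
      then obtain a b where ab: "a \<in> T - {j}" "b \<in> T - {j}" "a \<noteq> b"
        by (metis One_nat_def card_le_Suc0_iff_eq fin finite_Diff)
      then have "a < b \<or> b < a" by auto
      then show False
        using ab T by (auto simp: independent_sets_def rlex_independent_def subset_eq)
         (metis leD)+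
    qed
    then have "card T \<le> 2" using fin by (auto simp: card_Diff_singleton_if split: if_splits)
    then show False using T assms by (simp add: independent_sets_def)
  qed
  then show ?thesis by blast
qed

text \<open>Given positivity, only the pairs (0, 1) and (1, 2) could fail:
  \<open>a 0 \<ge> a 1\<close> would force 0 >= \<open>a 2\<close>, and \<open>a 1 \<le> a 2\<close>
  would force \<open>a 0\<close> <= 0. The strict inequalities exclude both premises.\<close>

lemma mid_heavy_three_terms:
  assumes "a 0 = 1" "1 < a 1" "a 2 < a 1" "0 < a 2"
  shows "mid_heavy 2 a"
proof -
  have z: "zero_extend 2 a p = (if p = 0 then a 0 else if p = 1 then a 1 else if p = 2 then a 2 else 0)" for p
    by (auto simp: zero_extend_def nat_eq_iff2 numeral_2_eq_2)
  have "0 < a m" if "m \<le> 2" for m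
    using that assms by (auto simp: le_Suc_eq numeral_2_eq_2)
  then show ?thesis unfolding mid_heavy_def z using assms by auto
qed

text \<open>Positivity is part of mid-heaviness, so a vanishing quadratic coefficient has to be
  treated as a sequence of length two.\<close>

lemma mid_heavy_two_terms:
  assumes "a 0 = 1" "1 \<le> a 1"
  shows "mid_heavy 1 a"
proof -
  have z: "zero_extend 1 a p = (if p = 0 then a 0 else if p = 1 then a 1 else 0)" for p
    by (auto simp: zero_extend_def nat_eq_iff2)
  have "0 < a m" if "m \<le> 1" for m
    using that assms by (auto simp: le_Suc_eq)
  then show ?thesis unfolding mid_heavy_def z using assms by auto
qed

text \<open>Induction on n starting from j, where the polynomial is 1 + j t + (j - 1 - i) t^2. The
  vanishing beyond N is carried along because the step at 1 + t needs it at N + 1, and because it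
  later identifies N as the top degree.\<close>

lemma mid_heavy_card_independent_sets:
  assumes "1 \<le> i" "i < j" "j \<le> n"
  shows "\<exists>N. mid_heavy N (\<lambda>d. card (independent_sets i j n d)) \<and>
    (\<forall>d>N. card (independent_sets i j n d) = 0)"
  using assms(3)
proof (induction n rule: dec_induct)
  case base
  let ?h = "\<lambda>d. card (independent_sets i j j d)"
  have h: "?h 0 = 1" "?h 1 = j" "?h 2 = j - 1 - i" "\<And>d. 3 \<le> d \<Longrightarrow> ?h d = 0"
    using card_independent_sets_1 card_independent_sets_2[OF assms(2)] independent_sets_ge_3
    by (auto simp: independent_sets_0)
  show ?case
  proof (cases "j - 1 - i = 0")
    case True
    then have "?h d = 0" if "1 < d" for d
      using h(3) h(4)[of d] that True by (cases "d = 2") auto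
    moreover have "mid_heavy 1 ?h" using h(1,2) assms by (intro mid_heavy_two_terms) auto
    ultimately show ?thesis by blast
  next
    case False
    have "?h d = 0" if "2 < d" for d using h(4) that by simp
    \<comment> \<open>The linear coefficient j exceeds 1 because 1 <= i < j.\<close>
    moreover have "mid_heavy 2 ?h" using h(1-3) assms False by (intro mid_heavy_three_terms) auto
    ultimately show ?thesis by blast
  qed
next
  case (step n)
  let ?h = "\<lambda>n d. card (independent_sets i j n d)"
  from step.IH obtain N where N: "mid_heavy N (?h n)" "\<forall>d>N. ?h n d = 0" by blast
  have rec: "?h (Suc n) (Suc d) = ?h n (Suc d) + ?h n d" for d
    using step.hyps by (intro card_independent_sets_Suc) auto
  have "mid_heavy (Suc N) (?h (Suc n))"
    using N rec by (intro mid_heavy_add_shift[where a = "?h n" and N = N]) (auto simp: independent_sets_0)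
  moreover have "?h (Suc n) d = 0" if "Suc N < d" for d
    using that N(2) rec[of "d - 1"] by (cases d) auto
  ultimately show ?case by blast
qed

section \<open>Monomial ideals and their quotients\<close>

text \<open>This is the k-linear span of the monomials in \<open>M\<close>. The ideals below have
  this form and the graded pieces of the quotient are images of such spans, so dimensions reduce to
  counting monomials.\<close>

definition supported :: "(nat \<Rightarrow>\<^sub>0 nat) set \<Rightarrow> ((nat \<Rightarrow>\<^sub>0 nat) \<Rightarrow>\<^sub>0 'k::field) set" where
  "supported M = {f. Poly_Mapping.keys f \<subseteq> M}"

lemma mpoly_ring_simps [simp]:
  "carrier (mpoly_ring n) = supported (monomials n)"
  "f \<otimes>\<^bsub>mpoly_ring n\<^esub> g = f * g"
  "f \<oplus>\<^bsub>mpoly_ring n\<^esub> g = f + g"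
  "\<one>\<^bsub>mpoly_ring n\<^esub> = 1"
  "\<zero>\<^bsub>mpoly_ring n\<^esub> = 0"
  by (simp_all add: mpoly_ring_def supported_def)

lemma zero_in_monomials [simp]: "0 \<in> monomials n"
  by (simp add: monomials_def)

lemma monomials_add: "a \<in> monomials n \<Longrightarrow> b \<in> monomials n \<Longrightarrow> a + b \<in> monomials n"
  using Poly_Mapping.keys_add[of a b] by (auto simp: monomials_def)

lemma supported_0 [simp]: "0 \<in> supported M"
  by (simp add: supported_def)

lemma supported_add: "f \<in> supported M \<Longrightarrow> g \<in> supported M \<Longrightarrow> f + g \<in> supported M"
  using Poly_Mapping.keys_add[of f g] by (auto simp: supported_def)

lemma supported_uminus: "f \<in> supported M \<Longrightarrow> - f \<in> supported M"
  by (simp add: supported_def)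

lemma supported_mult:
  assumes "f \<in> supported M" "g \<in> supported N" "\<And>a b. a \<in> M \<Longrightarrow> b \<in> N \<Longrightarrow> a + b \<in> L"
  shows "f * g \<in> supported L"
  using Poly_Mapping.keys_mult[of f g] assms unfolding supported_def by blast

lemma supported_mono: "f \<in> supported M \<Longrightarrow> M \<subseteq> N \<Longrightarrow> f \<in> supported N"
  by (auto simp: supported_def)

lemma keys_monom_poly [simp]: "Poly_Mapping.keys (monom_poly m :: _ \<Rightarrow>\<^sub>0 'k::field) = {m}"
  by (simp add: monom_poly_def)

lemma monom_poly_supported [simp]: "monom_poly m \<in> supported M \<longleftrightarrow> m \<in> M"
  by (simp add: supported_def)

lemma const_poly_supported: "const_poly c \<in> supported (monomials n)"
  by (auto simp: const_poly_def supported_def dest: subsetD[OF eq_refl[OF keys_single]] split: if_splits)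

lemma const_times_monom: "const_poly c * monom_poly m = Poly_Mapping.single m c"
  by (simp add: const_poly_def monom_poly_def mult_single)

text \<open>Splitting off a single term is the induction step in the later arguments over finite
  sets of monomials.\<close>

lemma supported_insertE:
  assumes "f \<in> supported (insert m M)"
  obtains g where "g \<in> supported M" and "f = const_poly (Poly_Mapping.lookup f m) * monom_poly m + g"
proof
  let ?g = "f - const_poly (Poly_Mapping.lookup f m) * monom_poly m"
  have "x \<in> M" if "x \<in> Poly_Mapping.keys ?g" for x
  proof (cases "x = m")
    case True
    with that show ?thesis by (simp add: const_times_monom in_keys_iff lookup_minus)
  next
    case False
    with that have "x \<in> Poly_Mapping.keys f"
      by (simp add: const_times_monom in_keys_iff lookup_minus lookup_single)
    with False assms show ?thesis by (auto simp: supported_def)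
  qed
  then show "?g \<in> supported M" by (auto simp: supported_def)
qed simp

lemma cring_mpoly_ring: "cring (mpoly_ring n :: ((nat \<Rightarrow>\<^sub>0 nat) \<Rightarrow>\<^sub>0 'k::field) ring)"
proof (rule cringI)
  show "abelian_group (mpoly_ring n :: ((nat \<Rightarrow>\<^sub>0 nat) \<Rightarrow>\<^sub>0 'k) ring)"
    by (rule abelian_groupI)
      (auto simp: supported_add algebra_simps intro!: bexI[of _ "- _"] supported_uminus)
  show "comm_monoid (mpoly_ring n :: ((nat \<Rightarrow>\<^sub>0 nat) \<Rightarrow>\<^sub>0 'k) ring)"
  proof (rule comm_monoidI)
    show "\<one>\<^bsub>mpoly_ring n\<^esub> \<in> carrier (mpoly_ring n :: ((nat \<Rightarrow>\<^sub>0 nat) \<Rightarrow>\<^sub>0 'k) ring)"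
      by (simp add: supported_def)
  qed (auto simp: algebra_simps intro: supported_mult monomials_add)
qed (auto simp: algebra_simps)

lemma a_inv_mpoly_ring:
  assumes "f \<in> supported (monomials n)"
  shows "\<ominus>\<^bsub>mpoly_ring n\<^esub> f = - f"
proof -
  interpret cring "mpoly_ring n :: ((nat \<Rightarrow>\<^sub>0 nat) \<Rightarrow>\<^sub>0 'a) ring" by (rule cring_mpoly_ring)
  show ?thesis using assms by (intro minus_equality) (auto simp: supported_uminus)
qed

text \<open>Dimensions are taken over a subfield of the ring itself, so the ground field has to be
  exhibited as one; its image will be the scalars of the quotient.\<close>

lemma subfield_const_poly: "subfield (range const_poly) (mpoly_ring n :: ((nat \<Rightarrow>\<^sub>0 nat) \<Rightarrow>\<^sub>0 'k::field) ring)"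
proof -
  interpret cring "mpoly_ring n :: ((nat \<Rightarrow>\<^sub>0 nat) \<Rightarrow>\<^sub>0 'k) ring" by (rule cring_mpoly_ring)
  let ?K = "range const_poly :: ((nat \<Rightarrow>\<^sub>0 nat) \<Rightarrow>\<^sub>0 'k) set"
  have one: "const_poly 1 = 1" and zero: "const_poly 0 = 0"
    and uminus: "- const_poly c = const_poly (- c)"
    and mult: "const_poly c * const_poly d = const_poly (c * d)"
    and add: "const_poly c + const_poly d = const_poly (c + d)" for c d :: 'k
    by (simp_all add: const_poly_def mult_single single_add single_uminus)
  have sub: "subring ?K (mpoly_ring n)"
    by (rule subringI)
      (auto simp: const_poly_supported a_inv_mpoly_ring uminus mult add intro: range_eqI[of _ _ 1] one[symmetric])
  show ?thesis
  proof (rule subfieldI[OF subcringI'[OF sub]])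
    show "Units (mpoly_ring n\<lparr>carrier := ?K\<rparr>) = ?K - {\<zero>\<^bsub>mpoly_ring n\<^esub>}"
    proof (intro equalityI subsetI)
      fix x assume "x \<in> Units (mpoly_ring n\<lparr>carrier := ?K\<rparr>)"
      then show "x \<in> ?K - {\<zero>\<^bsub>mpoly_ring n\<^esub>}" by (auto simp: Units_def)
    next
      fix x assume "x \<in> ?K - {\<zero>\<^bsub>mpoly_ring n\<^esub>}"
      then obtain c where c: "x = const_poly c" "c \<noteq> 0" using zero by auto
      then have "const_poly (inverse c) * x = 1" "x * const_poly (inverse c) = 1"
        by (simp_all add: mult one)
      then show "x \<in> Units (mpoly_ring n\<lparr>carrier := ?K\<rparr>)"
        using c by (auto simp: Units_def)
    qed
  qed
qed

section \<open>Ideals spanned by monomials\<close>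

lemma ideal_supported:
  assumes "J \<subseteq> monomials n" and "\<And>m h. m \<in> J \<Longrightarrow> h \<in> monomials n \<Longrightarrow> m + h \<in> J"
  shows "ideal (supported J) (mpoly_ring n :: ((nat \<Rightarrow>\<^sub>0 nat) \<Rightarrow>\<^sub>0 'k::field) ring)"
proof -
  interpret cring "mpoly_ring n :: ((nat \<Rightarrow>\<^sub>0 nat) \<Rightarrow>\<^sub>0 'k) ring" by (rule cring_mpoly_ring)
  have car: "f \<in> supported (monomials n)" if "f \<in> supported J" for f :: "_ \<Rightarrow>\<^sub>0 'k"
    using that assms(1) by (rule supported_mono)
  have sub: "subgroup (supported J) (add_monoid (mpoly_ring n :: ((nat \<Rightarrow>\<^sub>0 nat) \<Rightarrow>\<^sub>0 'k) ring))"
  proof (intro add.subgroupI)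
    fix f :: "_ \<Rightarrow>\<^sub>0 'k" assume "f \<in> supported J"
    then show "\<ominus>\<^bsub>mpoly_ring n\<^esub> f \<in> supported J"
      by (simp add: a_inv_mpoly_ring[OF car] supported_uminus)
  qed (auto simp: car supported_add intro: supported_0)
  show ?thesis
  proof (rule idealI[OF ring_axioms sub])
    fix f g :: "_ \<Rightarrow>\<^sub>0 'k"
    assume "f \<in> supported J" "g \<in> carrier (mpoly_ring n)"
    then show "f \<otimes>\<^bsub>mpoly_ring n\<^esub> g \<in> supported J"
      using assms(2) by (auto intro: supported_mult)
    then show "g \<otimes>\<^bsub>mpoly_ring n\<^esub> f \<in> supported J"
      by (simp add: mult.commute)
  qed
qed

text \<open>An ideal absorbs constants, so with the monomials of \<open>J\<close> it contains every
  finite linear combination of them.\<close>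

lemma supported_subset_ideal:
  fixes K :: "((nat \<Rightarrow>\<^sub>0 nat) \<Rightarrow>\<^sub>0 'k::field) set"
  assumes K: "ideal K (mpoly_ring n)" and monom: "\<And>m. m \<in> J \<Longrightarrow> monom_poly m \<in> K"
  shows "supported J \<subseteq> K"
proof
  interpret ideal K "mpoly_ring n" by (rule K)
  have ind: "f \<in> K" if "finite F" "F \<subseteq> J" "f \<in> supported F" for F f
    using that
  proof (induction F arbitrary: f rule: finite_induct)
    case empty
    then show ?case using additive_subgroup.zero_closed[OF is_additive_subgroup] by (auto simp: supported_def)
  next
    case (insert m F)
    obtain g where g: "g \<in> supported F" "f = const_poly (Poly_Mapping.lookup f m) * monom_poly m + g"
      using supported_insertE[OF insert.prems(2)] .
    have "const_poly (Poly_Mapping.lookup f m) * monom_poly m \<in> K"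
      using I_l_closed[of "monom_poly m" "const_poly (Poly_Mapping.lookup f m)"] monom insert.prems
      by (simp add: const_poly_supported)
    moreover have "g \<in> K" using insert g by simp
    ultimately show ?case using g(2) additive_subgroup.a_closed[OF is_additive_subgroup] by fastforce
  qed
  fix f :: "_ \<Rightarrow>\<^sub>0 'k" assume "f \<in> supported J"
  then show "f \<in> K" by (intro ind[of "Poly_Mapping.keys f"]) (auto simp: supported_def)
qed

text \<open>Monomials are exponent vectors, so multiplying them is addition of vectors.\<close>

definition multiples :: "nat \<Rightarrow> (nat \<Rightarrow>\<^sub>0 nat) set \<Rightarrow> (nat \<Rightarrow>\<^sub>0 nat) set" where
  "multiples n G = {g + h | g h. g \<in> G \<and> h \<in> monomials n}"

lemma multiples_subset: "G \<subseteq> monomials n \<Longrightarrow> multiples n G \<subseteq> monomials n"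
  by (auto simp: multiples_def intro: monomials_add)

lemma multiples_add:
  assumes "m \<in> multiples n G" "h \<in> monomials n"
  shows "m + h \<in> multiples n G"
proof -
  obtain g h' where "g \<in> G" "h' \<in> monomials n" "m = g + h'"
    using assms(1) by (auto simp: multiples_def)
  then have "m + h = g + (h' + h)" "h' + h \<in> monomials n"
    using assms(2) by (auto simp: add.assoc monomials_add)
  with \<open>g \<in> G\<close> show ?thesis unfolding multiples_def by blast
qed

lemma multiples_iff:
  assumes "m \<in> monomials n"
  shows "m \<in> multiples n G \<longleftrightarrow> (\<exists>g\<in>G. \<forall>v. Poly_Mapping.lookup g v \<le> Poly_Mapping.lookup m v)"
proof
  assume "\<exists>g\<in>G. \<forall>v. Poly_Mapping.lookup g v \<le> Poly_Mapping.lookup m v"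
  then obtain g where g: "g \<in> G" "\<And>v. Poly_Mapping.lookup g v \<le> Poly_Mapping.lookup m v" by blast
  \<comment> \<open>Subtraction of exponents is truncated, but nothing is lost because
    \<open>g\<close> is bounded by \<open>m\<close> in every coordinate.\<close>
  then have "m = g + (m - g)"
    by (intro poly_mapping_eqI) (simp add: lookup_add lookup_minus)
  moreover have "Poly_Mapping.keys (m - g) \<subseteq> Poly_Mapping.keys m"
    by (auto simp: in_keys_iff lookup_minus)
  then have "m - g \<in> monomials n" using assms by (auto simp: monomials_def)
  ultimately show "m \<in> multiples n G" using g(1) unfolding multiples_def by blast
next
  assume "m \<in> multiples n G"
  then obtain g h where "g \<in> G" "m = g + h" by (auto simp: multiples_def)
  then show "\<exists>g\<in>G. \<forall>v. Poly_Mapping.lookup g v \<le> Poly_Mapping.lookup m v"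
    by (intro bexI[of _ g]) (simp_all add: lookup_add)
qed

text \<open>The span of the multiples is an ideal containing the generators, and each multiple is a
  product of a generator with a monomial, so it lies in every such ideal.\<close>

lemma Idl_monom_poly:
  assumes "G \<subseteq> monomials n"
  shows "Idl\<^bsub>mpoly_ring n\<^esub> (monom_poly ` G) =
    (supported (multiples n G) :: ((nat \<Rightarrow>\<^sub>0 nat) \<Rightarrow>\<^sub>0 'k::field) set)"
proof -
  interpret cring "mpoly_ring n :: ((nat \<Rightarrow>\<^sub>0 nat) \<Rightarrow>\<^sub>0 'k) ring" by (rule cring_mpoly_ring)
  let ?G = "monom_poly ` G :: ((nat \<Rightarrow>\<^sub>0 nat) \<Rightarrow>\<^sub>0 'k) set"
  have car: "?G \<subseteq> carrier (mpoly_ring n)" using assms by auto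
  interpret I: ideal "Idl\<^bsub>mpoly_ring n\<^esub> ?G" "mpoly_ring n" by (rule genideal_ideal[OF car])
  show ?thesis
  proof
    have "ideal (supported (multiples n G)) (mpoly_ring n :: ((nat \<Rightarrow>\<^sub>0 nat) \<Rightarrow>\<^sub>0 'k) ring)"
      using multiples_subset[OF assms] multiples_add by (rule ideal_supported)
    moreover have "g \<in> multiples n G" if "g \<in> G" for g
      using that unfolding multiples_def by (intro CollectI exI[of _ g] exI[of _ 0]) simp
    then have "?G \<subseteq> supported (multiples n G)" by auto
    ultimately show "Idl\<^bsub>mpoly_ring n\<^esub> ?G \<subseteq> supported (multiples n G)"
      by (rule genideal_minimal)
    show "supported (multiples n G) \<subseteq> Idl\<^bsub>mpoly_ring n\<^esub> ?G"
    proof (rule supported_subset_ideal[OF I.is_ideal])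
      fix m assume "m \<in> multiples n G"
      then obtain g h where m: "g \<in> G" "h \<in> monomials n" "m = g + h"
        by (auto simp: multiples_def)
      then have "monom_poly g \<otimes>\<^bsub>mpoly_ring n\<^esub> monom_poly h \<in> Idl\<^bsub>mpoly_ring n\<^esub> ?G"
        using genideal_self[OF car] by (intro I.I_r_closed) auto
      then show "monom_poly m \<in> Idl\<^bsub>mpoly_ring n\<^esub> ?G"
        by (simp add: m(3) monom_poly_def mult_single)
    qed
  qed
qed

lemma multiples_Un: "multiples n (G \<union> H) = multiples n G \<union> multiples n H"
  unfolding multiples_def by blast

text \<open>Serves twice: to add the two ideals that make up I, and to split a form into a part
  inside the ideal and a part on the monomials outside it.\<close>

lemma supported_set_add:
  "supported M <+>\<^bsub>mpoly_ring n\<^esub> supported N = (supported (M \<union> N) :: ((nat \<Rightarrow>\<^sub>0 nat) \<Rightarrow>\<^sub>0 'k::field) set)"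
proof
  show "supported M <+>\<^bsub>mpoly_ring n\<^esub> supported N \<subseteq> (supported (M \<union> N) :: ((nat \<Rightarrow>\<^sub>0 nat) \<Rightarrow>\<^sub>0 'k) set)"
    by (auto simp: set_add_def' intro!: supported_add intro: supported_mono)
  have "f \<in> supported M <+>\<^bsub>mpoly_ring n\<^esub> supported N"
    if "finite F" "F \<subseteq> M \<union> N" "f \<in> supported F" for F and f :: "_ \<Rightarrow>\<^sub>0 'k"
    using that
  proof (induction F arbitrary: f rule: finite_induct)
    case empty
    then have "f = 0 + 0" by (simp add: supported_def)
    then show ?case unfolding set_add_def' 
      by (auto intro!: bexI[of _ 0])
  next
    case (insert m F)
    obtain g where g: "g \<in> supported F" "f = const_poly (Poly_Mapping.lookup f m) * monom_poly m + g"
      using supported_insertE[OF insert.prems(2)] .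
    then obtain a b where ab: "a \<in> supported M" "b \<in> supported N" "g = a + b"
      using insert by (fastforce simp: set_add_def')
    let ?s = "const_poly (Poly_Mapping.lookup f m) * monom_poly m"
    have s: "?s \<in> supported M \<or> ?s \<in> supported N"
      using insert.prems(1) by (auto simp: const_times_monom supported_def split: if_splits)
    have "f = (?s + a) + b" "f = a + (?s + b)"
      using g(2) ab(3) by (simp_all add: algebra_simps)
    then show ?case
      using s ab(1,2) supported_add unfolding set_add_def' mpoly_ring_simps by blast
  qed
  then show "supported (M \<union> N) \<subseteq> supported M <+>\<^bsub>mpoly_ring n\<^esub> (supported N :: ((nat \<Rightarrow>\<^sub>0 nat) \<Rightarrow>\<^sub>0 'k) set)"
    by (metis (no_types, lifting) finite_keys mem_Collect_eq order_refl subsetI supported_def)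
qed

section \<open>Graded pieces of the quotient by a monomial ideal\<close>

context
  fixes n :: nat and J :: "(nat \<Rightarrow>\<^sub>0 nat) set" and I :: "((nat \<Rightarrow>\<^sub>0 nat) \<Rightarrow>\<^sub>0 'k::field) set"
  assumes J: "J \<subseteq> monomials n" "\<And>m h. m \<in> J \<Longrightarrow> h \<in> monomials n \<Longrightarrow> m + h \<in> J" "0 \<notin> J"
    and I_eq: "I = supported J"
begin

abbreviation (input) "P \<equiv> mpoly_ring n :: ((nat \<Rightarrow>\<^sub>0 nat) \<Rightarrow>\<^sub>0 'k) ring"

interpretation cring P by (rule cring_mpoly_ring)
interpretation I: ideal I P unfolding I_eq using J(1,2) by (rule ideal_supported)
interpretation Q: ring "P Quot I" by (rule I.quotient_is_ring)
interpretation h: ring_hom_ring P "P Quot I" "(+>\<^bsub>P\<^esub>) I" by (rule I.rcos_ring_hom_ring)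

lemma coset_eq_iff:
  assumes "f \<in> supported (monomials n)" "g \<in> supported (monomials n)"
  shows "I +>\<^bsub>P\<^esub> f = I +>\<^bsub>P\<^esub> g \<longleftrightarrow> f - g \<in> I"
proof -
  have "I +>\<^bsub>P\<^esub> f = I +>\<^bsub>P\<^esub> g \<longleftrightarrow> f \<in> I +>\<^bsub>P\<^esub> g"
    using assms I.a_repr_independence'[of f g] I.a_repr_independenceD[of f g] by auto
  also have "\<dots> \<longleftrightarrow> f - g \<in> I"
    using I.a_rcos_module[of g f] assms by (simp add: a_inv_mpoly_ring)
  finally show ?thesis .
qed

lemma quot_scalars_subfield: "subfield (quot_scalars n I) (P Quot I)"
proof -
  \<comment> \<open>The exponent vector 0 is the monomial 1; its absence from \<open>J\<close> makes
    the quotient nonzero, so the image of the ground field is again a field.\<close>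
  have "1 \<notin> I" using J(3) by (simp add: I_eq supported_def)
  then have "\<one>\<^bsub>P Quot I\<^esub> \<noteq> \<zero>\<^bsub>P Quot I\<^esub>"
    using I.rcos_const_imp_mem[of 1] one_closed by (auto simp: FactRing_def)
  then have "subfield ((+>\<^bsub>P\<^esub>) I ` range const_poly) (P Quot I)"
    by (rule h.img_is_subfield(2)[OF subfield_const_poly])
  then show ?thesis by (simp add: quot_scalars_def image_image)
qed

text \<open>Monomials outside \<open>J\<close> stay linearly independent modulo the ideal. Adding
  \<open>m\<close> to \<open>F\<close> extends the space by a line: if the coset of \<open>m\<close>
  came from some f supported on \<open>F\<close>, then \<open>m\<close> would occur in an element of
  the ideal, contradicting that \<open>m\<close> is not in \<open>J\<close>.\<close>

lemma dimension_quot_supported: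
  assumes "finite F" "F \<subseteq> monomials n - J"
  shows "Q.dimension (card F) (quot_scalars n I) ((+>\<^bsub>P\<^esub>) I ` supported F)"
  using assms
proof (induction F rule: finite_induct)
  case empty
  have "(+>\<^bsub>P\<^esub>) I ` supported {} = {\<zero>\<^bsub>P Quot I\<^esub>}"
    using h.hom_zero by (auto simp: supported_def)
  then show ?case by simp
next
  case (insert m F)
  let ?v = "I +>\<^bsub>P\<^esub> monom_poly m" and ?E = "(+>\<^bsub>P\<^esub>) I ` supported F"
  have m: "(monom_poly m :: _ \<Rightarrow>\<^sub>0 'k) \<in> carrier P" using insert.prems by simp
  have F: "f \<in> carrier P" if "f \<in> supported F" for f :: "_ \<Rightarrow>\<^sub>0 'k"
    using that insert.prems by (auto intro: supported_mono)
  have "?v \<notin> ?E"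
  proof
    assume "?v \<in> ?E"
    then obtain f where f: "f \<in> supported F" "I +>\<^bsub>P\<^esub> monom_poly m = I +>\<^bsub>P\<^esub> f" by blast
    then have "monom_poly m - f \<in> I"
      using coset_eq_iff m F by simp
    moreover have "m \<in> Poly_Mapping.keys (monom_poly m - f)"
      using f(1) insert.hyps(2)
      by (auto simp: supported_def in_keys_iff lookup_minus monom_poly_def subset_eq)
    ultimately show False using insert.prems by (auto simp: I_eq supported_def)
  qed
  then have "Q.dimension (Suc (card F)) (quot_scalars n I) (Q.line_extension (quot_scalars n I) ?v ?E)"
    using insert h.hom_closed[OF m] by (intro Q.Suc_dim) auto
  moreover have "Q.line_extension (quot_scalars n I) ?v ?E = (+>\<^bsub>P\<^esub>) I ` supported (insert m F)"
  proof -
    have hom: "(I +>\<^bsub>P\<^esub> const_poly c) \<otimes>\<^bsub>P Quot I\<^esub> ?v \<oplus>\<^bsub>P Quot I\<^esub> (I +>\<^bsub>P\<^esub> f)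
        = I +>\<^bsub>P\<^esub> (const_poly c * monom_poly m + f)" if "f \<in> supported F" for c f
      using h.hom_mult[OF _ m, of "const_poly c"] h.hom_add[OF m_closed[OF _ m] F[OF that], of "const_poly c"]
      by (simp add: const_poly_supported)
    have "Q.line_extension (quot_scalars n I) ?v ?E =
        {I +>\<^bsub>P\<^esub> (const_poly c * monom_poly m + f) | c f. f \<in> supported F}"
      unfolding Q.line_extension_def set_add_def' r_coset_def quot_scalars_def
      by (auto simp: hom simp del: mpoly_ring_simps)
    also have "\<dots> = (+>\<^bsub>P\<^esub>) I ` supported (insert m F)"
    proof (intro equalityI subsetI)
      fix x assume "x \<in> (+>\<^bsub>P\<^esub>) I ` supported (insert m F)"
      then obtain f where "x = I +>\<^bsub>P\<^esub> f" "f \<in> supported (insert m F)" by blast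
      then show "x \<in> {I +>\<^bsub>P\<^esub> (const_poly c * monom_poly m + f) | c f. f \<in> supported F}"
        using supported_insertE by (smt (verit, best) mem_Collect_eq)
    next
      fix x assume "x \<in> {I +>\<^bsub>P\<^esub> (const_poly c * monom_poly m + f) | c f. f \<in> supported F}"
      then obtain c f where cf: "x = I +>\<^bsub>P\<^esub> (const_poly c * monom_poly m + f)" "f \<in> supported F"
        by blast
      have "const_poly c * monom_poly m + f \<in> supported (insert m F)"
        using cf(2)
        by (intro supported_add) (auto simp: const_times_monom supported_def split: if_splits)
      with cf(1) show "x \<in> (+>\<^bsub>P\<^esub>) I ` supported (insert m F)" by blast
    qed
    finally show ?thesis .
  qed
  ultimately show ?case using insert.hyps by simp
qed

text \<open>The terms of a form that lie in \<open>J\<close> vanish in the quotient, so the form can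
  be replaced by its part on the remaining monomials of the same degree.\<close>

lemma quot_graded_eq:
  "quot_graded n I d = (+>\<^bsub>P\<^esub>) I ` supported {m \<in> monomials n - J. mdeg m = d}"
proof (intro equalityI subsetI)
  fix x assume "x \<in> quot_graded n I d"
  then obtain f where f: "x = I +>\<^bsub>P\<^esub> f" "f \<in> supported (monomials n)" "homogeneous d f"
    by (auto simp: quot_graded_def)
  from f have "f \<in> supported (J \<union> {m \<in> monomials n - J. mdeg m = d})"
    by (auto simp: supported_def homogeneous_def)
  then obtain a b where ab: "a \<in> supported J" "b \<in> supported {m \<in> monomials n - J. mdeg m = d}" "f = a + b"
    unfolding supported_set_add[symmetric, where n = n] by (auto simp: set_add_def')
  then have "b \<in> supported (monomials n)" by (auto intro: supported_mono)
  with ab f have "x = I +>\<^bsub>P\<^esub> b" by (auto simp: coset_eq_iff I_eq[symmetric])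
  with ab(2) show "x \<in> (+>\<^bsub>P\<^esub>) I ` supported {m \<in> monomials n - J. mdeg m = d}" by blast
qed (auto simp: quot_graded_def homogeneous_def supported_def)

lemma dimension_quot_graded:
  assumes "finite {m \<in> monomials n - J. mdeg m = d}"
  shows "Q.dimension (card {m \<in> monomials n - J. mdeg m = d}) (quot_scalars n I) (quot_graded n I d)"
  unfolding quot_graded_eq using assms by (rule dimension_quot_supported) auto

lemma hilbert_series_nth:
  assumes "finite {m \<in> monomials n - J. mdeg m = d}"
  shows "fps_nth (hilbert_series (P Quot I) (quot_scalars n I) (quot_graded n I)) d =
    card {m \<in> monomials n - J. mdeg m = d}"
  using Q.dimI[OF quot_scalars_subfield dimension_quot_graded[OF assms]]
  by (simp add: hilbert_series_def)

text \<open>Translates the definition of the top degree into a statement about monomial counts: a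
  space is zero exactly when its dimension is 0.\<close>

lemma quot_graded_trivial_iff:
  assumes "finite {m \<in> monomials n - J. mdeg m = d}"
  shows "quot_graded n I d = {\<zero>\<^bsub>P Quot I\<^esub>} \<longleftrightarrow> {m \<in> monomials n - J. mdeg m = d} = {}"
proof
  assume "quot_graded n I d = {\<zero>\<^bsub>P Quot I\<^esub>}"
  then have "Q.dimension 0 (quot_scalars n I) (quot_graded n I d)" by simp
  then have "card {m \<in> monomials n - J. mdeg m = d} = 0"
    using Q.dimI[OF quot_scalars_subfield] dimension_quot_graded[OF assms] by metis
  with assms show "{m \<in> monomials n - J. mdeg m = d} = {}" by simp
next
  assume "{m \<in> monomials n - J. mdeg m = d} = {}"
  then show "quot_graded n I d = {\<zero>\<^bsub>P Quot I\<^esub>}"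
    using Q.dimension_zero[OF quot_scalars_subfield] dimension_quot_graded[OF assms] by (metis card.empty)
qed

end

section \<open>The generators of the ideal\<close>

text \<open>On finite sets this is the inverse of taking the support of a square-free
  monomial.\<close>

definition squarefree_of :: "nat set \<Rightarrow> nat \<Rightarrow>\<^sub>0 nat" where
  "squarefree_of T = (\<Sum>v\<in>T. mvar v)"

lemma lookup_mvar: "Poly_Mapping.lookup (mvar v) w = (if v = w then 1 else 0)"
  by (simp add: mvar_def lookup_single)

lemma lookup_squarefree_of:
  "finite T \<Longrightarrow> Poly_Mapping.lookup (squarefree_of T) v = (if v \<in> T then 1 else 0)"
  by (simp add: squarefree_of_def lookup_sum lookup_mvar)

lemma keys_squarefree_of [simp]: "finite T \<Longrightarrow> Poly_Mapping.keys (squarefree_of T) = T"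
  by (auto simp: in_keys_iff lookup_squarefree_of split: if_splits)

lemma squarefree_monomial_squarefree_of: "finite T \<Longrightarrow> squarefree_monomial (squarefree_of T)"
  by (simp add: squarefree_monomial_def lookup_squarefree_of)

lemma squarefree_lookup:
  "squarefree_monomial m \<Longrightarrow> Poly_Mapping.lookup m v = (if v \<in> Poly_Mapping.keys m then 1 else 0)"
  unfolding squarefree_monomial_def in_keys_iff by (metis One_nat_def le_Suc_eq le_zero_eq)

lemma squarefree_of_keys: "squarefree_monomial m \<Longrightarrow> squarefree_of (Poly_Mapping.keys m) = m"
  by (intro poly_mapping_eqI) (simp add: lookup_squarefree_of squarefree_lookup)

lemma mdeg_squarefree: "squarefree_monomial m \<Longrightarrow> mdeg m = card (Poly_Mapping.keys m)"
  by (simp add: mdeg_def squarefree_lookup)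

lemma mvar_add_mvar: "a \<noteq> b \<Longrightarrow> mvar a + mvar b = squarefree_of {a, b}"
  by (simp add: squarefree_of_def)

text \<open>For square-free monomials of equal degree the order asks that the largest index on which
  the supports differ belong to the smaller monomial. That index is j if b < j, and i if b = j and a
  < i.\<close>

lemma rlex_greater_iff:
  assumes "a < b" "i < j"
  shows "rlex_greater (squarefree_of {a, b}) (squarefree_of {i, j}) \<longleftrightarrow> b < j \<or> b = j \<and> a < i"
    (is "?L \<longleftrightarrow> ?R")
proof -
  have deg: "mdeg (squarefree_of {a, b}) = mdeg (squarefree_of {i, j})"
    using assms by (simp add: mdeg_squarefree squarefree_monomial_squarefree_of)
  have L: "?L \<longleftrightarrow> (\<exists>l. l \<in> {i, j} \<and> l \<notin> {a, b} \<and> (\<forall>l'>l. l' \<in> {a, b} \<longleftrightarrow> l' \<in> {i, j}))"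
  proof -
    have "Poly_Mapping.lookup (squarefree_of {a, b}) l < Poly_Mapping.lookup (squarefree_of {i, j}) l
        \<longleftrightarrow> l \<in> {i, j} \<and> l \<notin> {a, b}" for l
      by (simp add: lookup_squarefree_of)
    moreover have "Poly_Mapping.lookup (squarefree_of {a, b}) l = Poly_Mapping.lookup (squarefree_of {i, j}) l
        \<longleftrightarrow> (l \<in> {a, b} \<longleftrightarrow> l \<in> {i, j})" for l
      by (simp add: lookup_squarefree_of)
    ultimately show ?thesis by (simp add: rlex_greater_def deg)
  qed
  show ?thesis
  proof
    assume ?L
    with L obtain l where l: "l \<in> {i, j}" "l \<notin> {a, b}" "\<And>l'. l < l' \<Longrightarrow> l' \<in> {a, b} \<longleftrightarrow> l' \<in> {i, j}"
      by blast
    show ?R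
      using l(1,2) l(3)[of a] l(3)[of b] l(3)[of j] assms linorder_less_linear[of a i] by auto
  next
    assume ?R
    then show ?L
    proof
      assume "b < j"
      then show ?L unfolding L using assms by (intro exI[of _ j]) auto
    next
      assume "b = j \<and> a < i"
      then show ?L unfolding L using assms by (intro exI[of _ i]) auto
    qed
  qed
qed

text \<open>A square-free monomial of degree 2 is a pair a < b. Admitting equality with x_i x_j
  turns the strict a < i of the order into a <= i.\<close>

lemma rlex_monomials_eq:
  assumes "i < j"
  shows "rlex_monomials n (mvar i + mvar j) =
    {squarefree_of {a, b} | a b. 1 \<le> a \<and> a < b \<and> b \<le> n \<and> (b < j \<or> b = j \<and> a \<le> i)}"
proof (intro equalityI subsetI)
  fix m assume m: "m \<in> rlex_monomials n (mvar i + mvar j)"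
  then have sf: "squarefree_monomial m" and mn: "m \<in> monomials n"
    by (auto simp: rlex_monomials_def)
  then have "card (Poly_Mapping.keys m) = 2"
    using m by (simp add: rlex_monomials_def mdeg_squarefree)
  then obtain a b where ab: "Poly_Mapping.keys m = {a, b}" "a < b"
    by (metis card_2_iff insert_commute linorder_neqE_nat)
  then have meq: "m = squarefree_of {a, b}" using squarefree_of_keys[OF sf] by simp
  have "squarefree_of {a, b} = squarefree_of {i, j} \<or> b < j \<or> b = j \<and> a < i"
    using m assms ab(2) by (auto simp: rlex_monomials_def meq mvar_add_mvar rlex_greater_iff)
  moreover have "{a, b} = {i, j}" if "squarefree_of {a, b} = squarefree_of {i, j}"
    using arg_cong[OF that, of Poly_Mapping.keys] by simp
  ultimately have "b < j \<or> b = j \<and> a \<le> i"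
    using assms ab(2) by (auto simp: doubleton_eq_iff)
  moreover have "1 \<le> a" "b \<le> n" using mn ab by (auto simp: monomials_def)
  ultimately show "m \<in> {squarefree_of {a, b} | a b. 1 \<le> a \<and> a < b \<and> b \<le> n \<and> (b < j \<or> b = j \<and> a \<le> i)}"
    using meq ab(2) by blast
next
  fix m assume "m \<in> {squarefree_of {a, b} | a b. 1 \<le> a \<and> a < b \<and> b \<le> n \<and> (b < j \<or> b = j \<and> a \<le> i)}"
  then obtain a b where ab: "m = squarefree_of {a, b}" "1 \<le> a" "a < b" "b \<le> n" "b < j \<or> b = j \<and> a \<le> i"
    by blast
  then have "m = mvar i + mvar j \<or> rlex_greater m (mvar i + mvar j)"
    using assms by (cases "a = i") (auto simp: mvar_add_mvar rlex_greater_iff)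
  then show "m \<in> rlex_monomials n (mvar i + mvar j)"
    using ab by (auto simp: rlex_monomials_def mdeg_squarefree squarefree_monomial_squarefree_of monomials_def)
qed

definition ideal_generators :: "nat \<Rightarrow> nat \<Rightarrow> nat \<Rightarrow> (nat \<Rightarrow>\<^sub>0 nat) set" where
  "ideal_generators i j n = (\<lambda>v. mvar v + mvar v) ` {1..n} \<union> rlex_monomials n (mvar i + mvar j)"

lemma ideal_generators_subset: "ideal_generators i j n \<subseteq> monomials n"
  by (auto simp: ideal_generators_def rlex_monomials_def monomials_def in_keys_iff lookup_add lookup_mvar
      split: if_splits)

text \<open>Divisibility by a square x_v^2 means an exponent of at least 2, and divisibility by x_a
  x_b means that both indices lie in the support. Avoiding the two kinds of generators therefore
  gives the two conditions separately.\<close>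

lemma not_in_multiples_iff:
  assumes "i < j" and "m \<in> monomials n"
  shows "m \<notin> multiples n (ideal_generators i j n) \<longleftrightarrow>
    squarefree_monomial m \<and> rlex_independent i j (Poly_Mapping.keys m)"
proof -
  let ?l = "Poly_Mapping.lookup m"
  have keys: "v \<in> Poly_Mapping.keys m \<Longrightarrow> 1 \<le> v \<and> v \<le> n" for v
    using assms(2) by (auto simp: monomials_def)
  have sq: "(\<forall>w. Poly_Mapping.lookup (mvar v + mvar v) w \<le> ?l w) \<longleftrightarrow> 2 \<le> ?l v" for v
  proof -
    have "Poly_Mapping.lookup (mvar v + mvar v) w = (if v = w then 2 else 0)" for w
      by (simp add: lookup_add lookup_mvar)
    then show ?thesis by simp
  qed
  have pair: "(\<forall>w. Poly_Mapping.lookup (squarefree_of {a, b}) w \<le> ?l w) \<longleftrightarrow>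
      {a, b} \<subseteq> Poly_Mapping.keys m" for a b
  proof -
    have "Poly_Mapping.lookup (squarefree_of {a, b}) w \<le> ?l w \<longleftrightarrow>
        (w \<in> {a, b} \<longrightarrow> w \<in> Poly_Mapping.keys m)" for w
      by (auto simp: lookup_squarefree_of in_keys_iff Suc_le_eq)
    then show ?thesis by blast
  qed
  have "(\<exists>v\<in>{1..n}. 2 \<le> ?l v) \<longleftrightarrow> \<not> squarefree_monomial m"
  proof
    assume "\<not> squarefree_monomial m"
    then obtain v where "\<not> ?l v \<le> 1" unfolding squarefree_monomial_def by blast
    then have "2 \<le> ?l v" by simp
    moreover from this have "v \<in> {1..n}" using keys[of v] by (auto simp: in_keys_iff)
    ultimately show "\<exists>v\<in>{1..n}. 2 \<le> ?l v" by blast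
  next
    assume "\<exists>v\<in>{1..n}. 2 \<le> ?l v"
    then obtain v where "2 \<le> ?l v" by blast
    then have "\<not> ?l v \<le> 1" by simp
    then show "\<not> squarefree_monomial m" unfolding squarefree_monomial_def by blast
  qed
  moreover have "(\<exists>g\<in>rlex_monomials n (mvar i + mvar j). \<forall>w. Poly_Mapping.lookup g w \<le> ?l w) \<longleftrightarrow>
      \<not> rlex_independent i j (Poly_Mapping.keys m)"
  proof -
    have "(\<exists>g\<in>rlex_monomials n (mvar i + mvar j). \<forall>w. Poly_Mapping.lookup g w \<le> ?l w) \<longleftrightarrow>
        (\<exists>a b. {a, b} \<subseteq> Poly_Mapping.keys m \<and> 1 \<le> a \<and> a < b \<and> b \<le> n \<and> (b < j \<or> b = j \<and> a \<le> i))"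
      unfolding rlex_monomials_eq[OF assms(1)] pair[symmetric] by blast
    also have "\<dots> \<longleftrightarrow> \<not> rlex_independent i j (Poly_Mapping.keys m)"
    proof -
      have "b < j \<or> b = j \<and> a \<le> i \<longleftrightarrow> \<not> (j < b \<or> b = j \<and> i < a)" for a b
        by linarith
      then show ?thesis
        unfolding rlex_independent_def using keys by blast
    qed
    finally show ?thesis .
  qed
  ultimately show ?thesis
    unfolding multiples_iff[OF assms(2)] ideal_generators_def bex_Un by (simp add: sq)
qed

text \<open>Monomials outside the ideal are square-free, hence determined by their support, whose
  size is the degree.\<close>

lemma bij_betw_keys_independent_sets:
  assumes "i < j"
  shows "bij_betw Poly_Mapping.keys
    {m \<in> monomials n - multiples n (ideal_generators i j n). mdeg m = d} (independent_sets i j n d)"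
proof (rule bij_betw_byWitness[where f' = squarefree_of])
  have fin: "finite T" if "T \<subseteq> {1..n}" for T
    using that finite_subset by blast
  show "\<forall>m\<in>{m \<in> monomials n - multiples n (ideal_generators i j n). mdeg m = d}.
      squarefree_of (Poly_Mapping.keys m) = m"
    using not_in_multiples_iff[OF assms] by (auto simp: squarefree_of_keys)
  show "\<forall>T\<in>independent_sets i j n d. Poly_Mapping.keys (squarefree_of T) = T"
    using fin by (auto simp: independent_sets_def)
  show "Poly_Mapping.keys ` {m \<in> monomials n - multiples n (ideal_generators i j n). mdeg m = d}
      \<subseteq> independent_sets i j n d"
    using not_in_multiples_iff[OF assms]
    by (auto simp: independent_sets_def mdeg_squarefree monomials_def subset_eq)
  show "squarefree_of ` independent_sets i j n d
      \<subseteq> {m \<in> monomials n - multiples n (ideal_generators i j n). mdeg m = d}"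
  proof
    fix m assume "m \<in> squarefree_of ` independent_sets i j n d"
    then obtain T where T: "m = squarefree_of T" "T \<subseteq> {1..n}" "card T = d" "rlex_independent i j T"
      by (auto simp: independent_sets_def)
    then have m: "m \<in> monomials n" "squarefree_monomial m" "Poly_Mapping.keys m = T"
      using fin by (auto simp: monomials_def squarefree_monomial_squarefree_of)
    then show "m \<in> {m \<in> monomials n - multiples n (ideal_generators i j n). mdeg m = d}"
      using T not_in_multiples_iff[OF assms m(1)] by (simp add: mdeg_squarefree)
  qed
qed

lemma ideal_eq_supported_multiples:
  "squares_ideal n <+>\<^bsub>mpoly_ring n\<^esub> RLex n (mvar i + mvar j) =
    (supported (multiples n (ideal_generators i j n)) :: ((nat \<Rightarrow>\<^sub>0 nat) \<Rightarrow>\<^sub>0 'k::field) set)"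
proof -
  have "(\<lambda>v. monom_poly (mvar v) ^ 2 :: (nat \<Rightarrow>\<^sub>0 nat) \<Rightarrow>\<^sub>0 'k) ` {1..n} =
      monom_poly ` ((\<lambda>v. mvar v + mvar v) ` {1..n})"
    by (simp add: image_image power2_eq_square monom_poly_def mult_single)
  then have "squares_ideal n =
      (supported (multiples n ((\<lambda>v. mvar v + mvar v) ` {1..n})) :: ((nat \<Rightarrow>\<^sub>0 nat) \<Rightarrow>\<^sub>0 'k) set)"
    using ideal_generators_subset[of i j n] unfolding squares_ideal_def
    by (simp only: ideal_generators_def Un_subset_iff Idl_monom_poly)
  moreover have "RLex n (mvar i + mvar j) =
      (supported (multiples n (rlex_monomials n (mvar i + mvar j))) :: ((nat \<Rightarrow>\<^sub>0 nat) \<Rightarrow>\<^sub>0 'k) set)"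
    using ideal_generators_subset[of i j n] unfolding RLex_def
    by (simp only: ideal_generators_def Un_subset_iff Idl_monom_poly)
  ultimately show ?thesis
    by (simp only: supported_set_add ideal_generators_def multiples_Un)
qed

theorem corollary2p10:
  fixes n i j D :: nat
    and R :: "((nat \<Rightarrow>\<^sub>0 nat) \<Rightarrow>\<^sub>0 'k::field) ring"
    and I :: "((nat \<Rightarrow>\<^sub>0 nat) \<Rightarrow>\<^sub>0 'k) set"
    and A :: "((nat \<Rightarrow>\<^sub>0 nat) \<Rightarrow>\<^sub>0 'k) set ring"
  assumes "1 \<le> i" and "i < j" and "j \<le> n"
    and "R = mpoly_ring n"
    and "I = squares_ideal n <+>\<^bsub>R\<^esub> RLex n (mvar i + mvar j)"
    and "A = R Quot I"
    and "D = top_degree A (quot_graded n I)"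
  shows "mid_heavy D (fps_nth (hilbert_series A (quot_scalars n I) (quot_graded n I)))"
proof -
  let ?J = "multiples n (ideal_generators i j n)"
  let ?S = "\<lambda>d. {m \<in> monomials n - ?J. mdeg m = d}"
  let ?h = "\<lambda>d. card (independent_sets i j n d)"
  have J: "?J \<subseteq> monomials n" "\<And>m h. m \<in> ?J \<Longrightarrow> h \<in> monomials n \<Longrightarrow> m + h \<in> ?J" "0 \<notin> ?J"
    using multiples_subset[OF ideal_generators_subset] multiples_add
      not_in_multiples_iff[OF \<open>i < j\<close> zero_in_monomials]
    by (auto simp: squarefree_monomial_def rlex_independent_def)
  have I: "I = supported ?J"
    using assms(4,5) by (simp add: ideal_eq_supported_multiples)
  note bij = bij_betw_keys_independent_sets[OF \<open>i < j\<close>, of n]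
  \<comment> \<open>The bijection transports finiteness from the subsets of {1, ..., n}, which the
    dimension formulas require.\<close>
  have fin: "finite (?S d)" for d
    using bij_betw_finite[OF bij] finite_independent_sets by blast
  have card: "card (?S d) = ?h d" for d
    by (rule bij_betw_same_card[OF bij])
  have series: "fps_nth (hilbert_series A (quot_scalars n I) (quot_graded n I)) = ?h"
    by (intro ext) (simp add: assms(4,6) hilbert_series_nth[OF J I fin] card[simplified])
  have "quot_graded n I d = {\<zero>\<^bsub>A\<^esub>} \<longleftrightarrow> ?S d = {}" for d
    unfolding assms(4,6) by (rule quot_graded_trivial_iff[OF J I fin])
  then have "quot_graded n I d \<noteq> {\<zero>\<^bsub>A\<^esub>} \<longleftrightarrow> ?h d \<noteq> 0" for d
    by (simp only: card[symmetric] card_0_eq[OF fin])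
  then have D: "D = (GREATEST d. ?h d \<noteq> 0)"
    by (simp only: assms(7) top_degree_def)
  obtain N where N: "mid_heavy N ?h" "\<forall>d>N. ?h d = 0"
    using mid_heavy_card_independent_sets[OF assms(1-3)] by blast
  \<comment> \<open>Positivity at N makes the degree N piece nonzero, and all later pieces
    vanish.\<close>
  have "D = N"
    unfolding D
  proof (rule Greatest_equality)
    show "?h N \<noteq> 0" using N(1) by (simp add: mid_heavy_def)
    show "d \<le> N" if "?h d \<noteq> 0" for d using N(2) that by (meson not_le)
  qed
  with N(1) series show ?thesis by simp
qed

end
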